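(* Let $E$ be a complex elliptic curve with complex multiplication (i.e. $\operatorname{End}(E)\neq\mathbb Z$). Then for every integer $g>1$ there are in $E^g$ infinitely many extra-ordinary elliptic curves.
   Context: "Elliptic curve in" a complex torus $A$ means a one-dimensional complex subtorus of $A$ (so it passes through the origin). For a primitive vector $v=(v_1,\dots,v_g)\in\mathbb Z^g$ (i.e. $\gcd(v_1,\dots,v_g)=1$), let $E_v\subset E^g$ be the image of the embedding $E\to E^g$, $x\mapsto(v_1x,\dots,v_gx)$. The elliptic curves $E_v$, with $v\in\mathbb Z^g$ primitive, are called the ordinary elliptic curves in $E^g$; an elliptic curve in $E^g$ is extra-ordinary if it is not ordinary. *)

theory Defs
  imports "HOL-Analysis.Analysis" "HOL-Library.Set_Algebras"
begin

text \<open>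
  A complex torus is \<open>V / L\<close> with \<open>V\<close> a finite-dimensional complex vector space and
  \<open>L\<close> a lattice in \<open>V\<close>. Its points are the cosets \<open>z +o L\<close>, and
  its group law is the addition of sets from \<^theory>\<open>HOL-Library.Set_Algebras\<close>.
\<close>

text \<open>The \<open>span\<close> here is the real span, so that \<open>M\<close> has full rank in \<open>W\<close>.\<close>

definition lattice_in :: "'a::euclidean_space set \<Rightarrow> 'a set \<Rightarrow> bool" where
  "lattice_in W M \<longleftrightarrow>
     0 \<in> M \<and> (\<forall>x\<in>M. \<forall>y\<in>M. x - y \<in> M) \<and> discrete M \<and> span M = W"

definition torus :: "'a::ab_group_add set \<Rightarrow> 'a set set" where
  "torus L = range (\<lambda>z. z +o L)"

text \<open>The map \<open>V / L \<rightarrow> V' / M\<close> induced by a homomorphism \<open>\<phi> : V \<rightarrow> V'\<close> that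
  maps \<open>L\<close> into \<open>M\<close>.\<close>

definition induced_map :: "'b::ab_group_add set \<Rightarrow> ('a \<Rightarrow> 'b) \<Rightarrow> 'a set \<Rightarrow> 'b set" where
  "induced_map M \<phi> X = (\<Union>z\<in>X. \<phi> z +o M)"

lemma induced_map_coset:
  fixes \<phi> :: "'a::ab_group_add \<Rightarrow> 'b::ab_group_add"
  assumes "0 \<in> L" "0 \<in> M" and M: "\<And>x y. x \<in> M \<Longrightarrow> y \<in> M \<Longrightarrow> x - y \<in> M"
    and add: "\<And>x y. \<phi> (x + y) = \<phi> x + \<phi> y" and "\<phi> ` L \<subseteq> M"
  shows "induced_map M \<phi> (z +o L) = \<phi> z +o M"
proof -
  have plus: "x + y \<in> M" if "x \<in> M" "y \<in> M" for x y
    using M[OF that(1) M[OF \<open>0 \<in> M\<close> that(2)]] by simp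
  show ?thesis
  proof (intro equalityI subsetI)
    fix w assume "w \<in> induced_map M \<phi> (z +o L)"
    then obtain l m where "l \<in> L" "m \<in> M" "w = \<phi> (z + l) + m"
      by (auto simp: induced_map_def elt_set_plus_def)
    moreover from \<open>l \<in> L\<close> have "\<phi> l \<in> M" using assms by blast
    ultimately show "w \<in> \<phi> z +o M"
      using plus[of "\<phi> l" m] by (auto simp: add elt_set_plus_def add.assoc)
  next
    fix w assume "w \<in> \<phi> z +o M"
    then show "w \<in> induced_map M \<phi> (z +o L)"
      using \<open>0 \<in> L\<close> by (force simp: induced_map_def elt_set_plus_def)
  qed
qed

text \<open>Throughout, \<open>E\<close> is \<open>\<complex> / \<Lambda>\<close>. Since \<open>\<complex> \<rightarrow> \<complex> / \<Lambda>\<close>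
  is a local biholomorphism, a map \<open>E \<rightarrow> E\<close> is holomorphic iff its composition with the projection
  locally lifts to holomorphic functions.\<close>

definition torus_holomorphic :: "complex set \<Rightarrow> (complex set \<Rightarrow> complex set) \<Rightarrow> bool" where
  "torus_holomorphic \<Lambda> f \<longleftrightarrow>
     (\<forall>z. \<exists>U h. open U \<and> z \<in> U \<and> h holomorphic_on U \<and> (\<forall>w\<in>U. f (w +o \<Lambda>) = h w +o \<Lambda>))"

definition End_torus :: "complex set \<Rightarrow> (complex set \<Rightarrow> complex set) set" where
  "End_torus \<Lambda> =
     {f \<in> torus \<Lambda> \<rightarrow>\<^sub>E torus \<Lambda>.
        (\<forall>X\<in>torus \<Lambda>. \<forall>Y\<in>torus \<Lambda>. f (X + Y) = f X + f Y) \<and> torus_holomorphic \<Lambda> f}"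

definition int_mult :: "complex set \<Rightarrow> int \<Rightarrow> complex set \<Rightarrow> complex set" where
  "int_mult \<Lambda> n = restrict (induced_map \<Lambda> (\<lambda>z. of_int n * z)) (torus \<Lambda>)"

definition complex_multiplication :: "complex set \<Rightarrow> bool" where
  "complex_multiplication \<Lambda> \<longleftrightarrow> End_torus \<Lambda> \<noteq> range (int_mult \<Lambda>)"

text \<open>\<open>E\<^sup>g\<close> is \<open>\<complex>\<^sup>g / \<Lambda>\<^sup>g\<close>, where \<open>g\<close> is the cardinality of the index type.\<close>

definition lattice_power :: "complex set \<Rightarrow> (complex ^ 'n) set" where
  "lattice_power \<Lambda> = {z. \<forall>i. z $ i \<in> \<Lambda>}"

text \<open>A \<open>d\<close>-dimensional complex subtorus of \<open>\<complex>\<^sup>n / L\<close> is the image of a complex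
  subspace \<open>W\<close> of dimension \<open>d\<close> for which \<open>L \<inter> W\<close> is a lattice in \<open>W\<close>. The operations
  prefixed with \<open>vec\<close> are those of the complex vector space.\<close>

definition complex_subtorus :: "(complex ^ 'n) set \<Rightarrow> nat \<Rightarrow> (complex ^ 'n) set set \<Rightarrow> bool" where
  "complex_subtorus L d T \<longleftrightarrow>
     (\<exists>W. vec.subspace W \<and> vec.dim W = d \<and> lattice_in W (L \<inter> W) \<and> T = (\<lambda>z. z +o L) ` W)"

definition elliptic_curve_in :: "(complex ^ 'n) set \<Rightarrow> (complex ^ 'n) set set \<Rightarrow> bool" where
  "elliptic_curve_in L T \<longleftrightarrow> complex_subtorus L 1 T"

definition primitive :: "int ^ 'n \<Rightarrow> bool" where
  "primitive v \<longleftrightarrow> Gcd (range (\<lambda>i. v $ i)) = 1"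

definition ordinary_map :: "complex set \<Rightarrow> int ^ 'n \<Rightarrow> complex set \<Rightarrow> (complex ^ 'n) set" where
  "ordinary_map \<Lambda> v = induced_map (lattice_power \<Lambda>) (\<lambda>z. \<chi> i. of_int (v $ i) * z)"

definition ordinary_curve :: "complex set \<Rightarrow> int ^ 'n \<Rightarrow> (complex ^ 'n) set set" where
  "ordinary_curve \<Lambda> v = ordinary_map \<Lambda> v ` torus \<Lambda>"

definition extra_ordinary :: "complex set \<Rightarrow> (complex ^ 'n) set set \<Rightarrow> bool" where
  "extra_ordinary \<Lambda> C \<longleftrightarrow>
     elliptic_curve_in (lattice_power \<Lambda>) C \<and> \<not> (\<exists>v. primitive v \<and> C = ordinary_curve \<Lambda> v)"

lemma lattice_of_int_mult:
  fixes \<Lambda> :: "complex set"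
  assumes "lattice_in UNIV \<Lambda>" "x \<in> \<Lambda>"
  shows "of_int n * x \<in> \<Lambda>"
proof -
  have diff: "a - b \<in> \<Lambda>" if "a \<in> \<Lambda>" "b \<in> \<Lambda>" for a b
    using assms(1) that by (auto simp: lattice_in_def)
  have "0 \<in> \<Lambda>" using assms(1) by (simp add: lattice_in_def)
  have add: "a + b \<in> \<Lambda>" if "a \<in> \<Lambda>" "b \<in> \<Lambda>" for a b
    using diff[OF that(1) diff[OF \<open>0 \<in> \<Lambda>\<close> that(2)]] by simp
  show ?thesis
    by (induction n rule: int_induct[where k = 0])
       (use assms(2) \<open>0 \<in> \<Lambda>\<close> in \<open>auto simp: distrib_right left_diff_distrib intro: add diff\<close>)
qed

lemma torus_add:
  fixes L :: "'a::euclidean_space set"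
  assumes "lattice_in W L"
  shows "(x +o L) + (y +o L) = (x + y) +o L"
proof -
  have "L + L = L"
  proof (intro equalityI subsetI)
    fix w assume "w \<in> L + L"
    then obtain a b where ab: "a \<in> L" "b \<in> L" "w = a + b" by (auto simp: set_plus_def)
    have "a - (0 - b) \<in> L" using assms ab unfolding lattice_in_def by blast
    then show "w \<in> L" using ab by simp
  next
    fix w assume "w \<in> L"
    then show "w \<in> L + L"
      using assms by (force simp: lattice_in_def set_plus_def)
  qed
  then show ?thesis by (simp add: set_plus_rearrange)
qed

lemma int_mult_coset:
  assumes "lattice_in UNIV \<Lambda>"
  shows "int_mult \<Lambda> n (z +o \<Lambda>) = (of_int n * z) +o \<Lambda>"
proof -
  have "induced_map \<Lambda> (\<lambda>z. of_int n * z) (z +o \<Lambda>) = (of_int n * z) +o \<Lambda>"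
    by (rule induced_map_coset)
       (use assms lattice_of_int_mult[OF assms] in \<open>auto simp: lattice_in_def distrib_left\<close>)
  then show ?thesis by (simp add: int_mult_def torus_def)
qed

lemma int_mult_in_End:
  assumes "lattice_in UNIV \<Lambda>"
  shows "int_mult \<Lambda> n \<in> End_torus \<Lambda>"
proof -
  have "int_mult \<Lambda> n \<in> torus \<Lambda> \<rightarrow>\<^sub>E torus \<Lambda>"
    using int_mult_coset[OF assms, of n]
    by (auto simp: torus_def int_mult_def extensional_def)
  moreover have "torus_holomorphic \<Lambda> (int_mult \<Lambda> n)"
    unfolding torus_holomorphic_def int_mult_coset[OF assms]
    by (intro allI exI[of _ UNIV] exI[of _ "\<lambda>z. of_int n * z"])
       (auto intro!: holomorphic_intros)
  ultimately show ?thesis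
    by (auto simp: End_torus_def torus_def torus_add[OF assms] int_mult_coset[OF assms]
        distrib_left)
qed

lemma ordinary_map_coset:
  fixes v :: "int ^ 'n"
  assumes "lattice_in UNIV \<Lambda>"
  shows "ordinary_map \<Lambda> v (z +o \<Lambda>) = (\<chi> i. of_int (v $ i) * z) +o lattice_power \<Lambda>"
  unfolding ordinary_map_def
  by (rule induced_map_coset)
     (use assms lattice_of_int_mult[OF assms] in
       \<open>auto simp: lattice_in_def lattice_power_def distrib_left vec_eq_iff\<close>)

end

theory Submission
  imports Defs
begin

text \<open>
  A holomorphic endomorphism of \<open>\<complex> / \<Lambda>\<close> lifts near \<open>0\<close> to a function that is
  additive up to elements of \<open>\<Lambda>\<close>, hence additive by continuity and discreteness, hence
  multiplication by its derivative \<open>\<alpha>\<close> at \<open>0\<close>. Then \<open>\<alpha> \<Lambda> \<subseteq> \<Lambda>\<close>, and complex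
  multiplication provides such an \<open>\<alpha>\<close> that is not an integer. It is not real either: otherwise the powers
  of its fractional part would move a nonzero period arbitrarily close to \<open>0\<close>.

  For two indices \<open>a \<noteq> b\<close> and an integer \<open>k \<ge> 1\<close>, the line spanned by \<open>e\<^sub>a + k \<alpha> e\<^sub>b\<close> meets
  \<open>\<Lambda>\<^sup>g\<close> in a copy of \<open>\<Lambda>\<close> and so gives an elliptic curve \<open>C\<^sub>k\<close>. The linear form
  \<open>k \<alpha> x\<^sub>a - x\<^sub>b\<close> maps \<open>C\<^sub>k\<close> into \<open>\<Lambda>\<close>, which separates the curves, and the form
  \<open>v\<^sub>b x\<^sub>a - v\<^sub>a x\<^sub>b\<close> maps \<open>E\<^sub>v\<close> into \<open>\<Lambda>\<close>, so \<open>C\<^sub>k = E\<^sub>v\<close> would force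
  \<open>k \<alpha>\<close> to be rational.
\<close>

section \<open>Cosets and discreteness of a lattice\<close>

context
  fixes L :: "'a::euclidean_space set" and W :: "'a set"
  assumes lattice: "lattice_in W L"
begin

lemma lattice_zero: "0 \<in> L"
  using lattice by (simp add: lattice_in_def)

lemma lattice_diff: "x \<in> L \<Longrightarrow> y \<in> L \<Longrightarrow> x - y \<in> L"
  using lattice by (simp add: lattice_in_def)

lemma lattice_uminus: "x \<in> L \<Longrightarrow> - x \<in> L"
  using lattice_diff[OF lattice_zero, of x] by simp

lemma lattice_add: "x \<in> L \<Longrightarrow> y \<in> L \<Longrightarrow> x + y \<in> L"
  using lattice_diff[of x "- y"] lattice_uminus[of y] by simp

lemma lattice_coset_eq_iff: "x +o L = y +o L \<longleftrightarrow> x - y \<in> L"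
proof
  assume "x +o L = y +o L"
  then have "x + 0 \<in> y +o L"
    using lattice_zero by blast
  then show "x - y \<in> L"
    by (auto simp: elt_set_plus_def)
next
  have sub: "x +o L \<subseteq> y +o L" if "x - y \<in> L" for x y
  proof
    fix w assume "w \<in> x +o L"
    then obtain l where "l \<in> L" "w = x + l"
      by (auto simp: elt_set_plus_def)
    with that have "x - y + l \<in> L" "w = y + (x - y + l)"
      by (auto intro: lattice_add)
    then show "w \<in> y +o L"
      by blast
  qed
  assume "x - y \<in> L"
  with lattice_uminus[OF this] show "x +o L = y +o L"
    using sub[of x y] sub[of y x] by simp
qed

lemma lattice_coset_eq_lattice_iff: "x +o L = L \<longleftrightarrow> x \<in> L"
  using lattice_coset_eq_iff[of x 0] by simp

text \<open>The form in which discreteness enters all later arguments: a lattice element that is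
  known to be small must vanish.\<close>

lemma lattice_gap:
  obtains e where "e > 0" "\<And>x. x \<in> L \<Longrightarrow> norm x < e \<Longrightarrow> x = 0"
proof -
  have "0 isolated_in L"
    using lattice by (auto simp: lattice_in_def discrete_def)
  then obtain e where "e > 0" "\<forall>y\<in>L. dist 0 y < e \<longrightarrow> y = 0"
    by (auto simp: isolated_in_dist_Ex_iff)
  then show ?thesis
    using that by auto
qed

end

section \<open>Holomorphic endomorphisms of the torus\<close>

context
  fixes \<Lambda> :: "complex set"
  assumes lattice: "lattice_in UNIV \<Lambda>"
begin

lemma End_torus_add:
  assumes "f \<in> End_torus \<Lambda>"
  shows "f ((x + y) +o \<Lambda>) = f (x +o \<Lambda>) + f (y +o \<Lambda>)"
proof -
  have "f ((x +o \<Lambda>) + (y +o \<Lambda>)) = f (x +o \<Lambda>) + f (y +o \<Lambda>)"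
    using assms unfolding End_torus_def torus_def by blast
  then show ?thesis
    by (simp only: torus_add[OF lattice])
qed

text \<open>Lets the value at \<open>z / n\<close> determine the value at \<open>z\<close>, which
  turns a description of \<open>f\<close> near 0 into a global one. The case \<open>n = 0\<close>
  shows that \<open>f\<close> fixes the neutral coset.\<close>

lemma End_torus_of_nat_mult:
  assumes "f \<in> End_torus \<Lambda>" and w: "f (w +o \<Lambda>) = u +o \<Lambda>"
  shows "f ((of_nat n * w) +o \<Lambda>) = (of_nat n * u) +o \<Lambda>"
proof -
  have "\<Lambda> \<in> torus \<Lambda>"
    unfolding torus_def by (rule range_eqI[of _ _ 0]) simp
  then have "f \<Lambda> \<in> torus \<Lambda>"
    using assms(1) unfolding End_torus_def by blast
  then obtain c where c: "f \<Lambda> = c +o \<Lambda>"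
    by (auto simp: torus_def)
  \<comment> \<open>The coset \<open>f \<Lambda>\<close> equals its own double, so it is
    neutral.\<close>
  have "c +o \<Lambda> = (c + c) +o \<Lambda>"
    using End_torus_add[OF assms(1), of 0 0] by (simp add: c torus_add[OF lattice])
  then have "c - (c + c) \<in> \<Lambda>"
    unfolding lattice_coset_eq_iff[OF lattice] .
  then have "c \<in> \<Lambda>"
    using lattice_uminus[OF lattice, of "-c"] by simp
  then have zero: "f \<Lambda> = \<Lambda>"
    unfolding c lattice_coset_eq_lattice_iff[OF lattice] .
  show ?thesis
  proof (induction n)
    case 0
    show ?case using zero by simp
  next
    case (Suc n)
    have "f ((of_nat (Suc n) * w) +o \<Lambda>) = f (w +o \<Lambda>) + f ((of_nat n * w) +o \<Lambda>)"
      using End_torus_add[OF assms(1), of w "of_nat n * w"] by (simp add: distrib_right)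
    also have "\<dots> = (of_nat (Suc n) * u) +o \<Lambda>"
      unfolding Suc.IH w torus_add[OF lattice] by (simp add: distrib_right)
    finally show ?case .
  qed
qed

text \<open>The additivity defect \<open>k (u + w) - (k u + k w)\<close> is a period because
  \<open>k\<close> lifts \<open>f\<close>, and it is small by continuity, so it is zero.\<close>

lemma End_torus_local_lift:
  assumes f: "f \<in> End_torus \<Lambda>"
  obtains d k \<alpha> where "d > 0" "(k has_field_derivative \<alpha>) (at 0)"
    "\<And>u w. norm u < d \<Longrightarrow> norm w < d \<Longrightarrow> norm (u + w) < d \<Longrightarrow> k (u + w) = k u + k w"
    "\<And>w. norm w < d \<Longrightarrow> f (w +o \<Lambda>) = k w +o \<Lambda>"
proof -
  have "torus_holomorphic \<Lambda> f"
    using f by (simp add: End_torus_def)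
  then obtain U h where U: "open U" "0 \<in> U" "h holomorphic_on U"
    and fh: "\<And>w. w \<in> U \<Longrightarrow> f (w +o \<Lambda>) = h w +o \<Lambda>"
    unfolding torus_holomorphic_def by metis
  obtain e where e: "e > 0" "\<And>x. x \<in> \<Lambda> \<Longrightarrow> norm x < e \<Longrightarrow> x = 0"
    using lattice_gap[OF lattice] by blast
  obtain \<alpha> where \<alpha>: "(h has_field_derivative \<alpha>) (at 0)"
    using U by (auto simp: holomorphic_on_open)
  obtain d1 where d1: "d1 > 0" "ball 0 d1 \<subseteq> U"
    using U(1,2) by (auto simp: open_contains_ball)
  have "isCont h 0"
    using \<alpha> by (rule DERIV_isCont)
  \<comment> \<open>Three values of \<open>k\<close>, each below \<open>e / 3\<close>, keep the
    additivity defect below the gap \<open>e\<close>.\<close>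
  then have "\<exists>d2>0. \<forall>w. norm (w - 0) < d2 \<longrightarrow> norm (h w - h 0) < e / 3"
    using e(1) unfolding continuous_at_eps_delta dist_norm
    by (meson divide_pos_pos zero_less_numeral)
  then obtain d2 where d2: "d2 > 0" "\<And>w. norm w < d2 \<Longrightarrow> norm (h w - h 0) < e / 3"
    by auto
  have "f \<Lambda> = \<Lambda>"
    using End_torus_of_nat_mult[OF f fh[OF U(2)], of 0] by simp
  then have h0: "h 0 \<in> \<Lambda>"
    using fh[OF U(2)] lattice_coset_eq_lattice_iff[OF lattice, of "h 0"] by simp
  \<comment> \<open>Subtracting the period \<open>h 0\<close> gives another lift, which is small
    near 0.\<close>
  define k where "k w = h w - h 0" for w
  define d where "d = min d1 d2"
  have fk: "f (w +o \<Lambda>) = k w +o \<Lambda>" if "norm w < d" for w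
  proof -
    have "w \<in> U"
      using that d1(2) by (auto simp: d_def)
    moreover have "h w +o \<Lambda> = k w +o \<Lambda>"
      using h0 by (simp add: lattice_coset_eq_iff[OF lattice] k_def)
    ultimately show ?thesis
      using fh by simp
  qed
  have "k (u + w) = k u + k w" if "norm u < d" "norm w < d" "norm (u + w) < d" for u w
  proof -
    have "k (u + w) +o \<Lambda> = (k u + k w) +o \<Lambda>"
      using End_torus_add[OF f, of u w]
      by (simp only: fk that torus_add[OF lattice])
    then have "k (u + w) - (k u + k w) \<in> \<Lambda>"
      by (simp add: lattice_coset_eq_iff[OF lattice])
    moreover have "norm (k (u + w) - (k u + k w)) < e"
    proof -
      have "norm (k u) < e / 3" "norm (k w) < e / 3" "norm (k (u + w)) < e / 3"
        using that d2(2) by (auto simp: k_def d_def)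
      then show ?thesis
        using norm_triangle_ineq4[of "k (u + w)" "k u + k w"] norm_triangle_ineq[of "k u" "k w"]
        by linarith
    qed
    ultimately have "k (u + w) - (k u + k w) = 0"
      by (rule e(2))
    then show ?thesis
      by simp
  qed
  moreover have "(k has_field_derivative \<alpha>) (at 0)"
    unfolding k_def using \<alpha> by (auto intro!: derivative_eq_intros)
  moreover have "d > 0"
    using d1 d2 by (simp add: d_def)
  ultimately show ?thesis
    using that[of d k \<alpha>] fk by simp
qed

text \<open>Additivity gives \<open>k (z / n) = k z / n\<close>, so the difference quotient at 0 is
  constantly \<open>k z / z\<close> along the points \<open>z / n\<close>, while it tends to
  \<alpha>.\<close>

lemma locally_additive_eq_mult:
  fixes k :: "complex \<Rightarrow> complex"
  assumes deriv: "(k has_field_derivative \<alpha>) (at 0)"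
    and add: "\<And>u w. norm u < d \<Longrightarrow> norm w < d \<Longrightarrow> norm (u + w) < d \<Longrightarrow> k (u + w) = k u + k w"
    and z: "norm z < d"
  shows "k z = \<alpha> * z"
proof -
  have "0 < d"
    using z norm_ge_zero[of z] by linarith
  have k0: "k 0 = 0"
    using add[of 0 0] \<open>0 < d\<close> by simp
  have mult: "k (of_nat n * w) = of_nat n * k w" if "norm (of_nat n * w) < d" for n w
    using that
  proof (induction n)
    case 0
    then show ?case using k0 by simp
  next
    case (Suc n)
    \<comment> \<open>Additivity holds only inside the disc, so the summands \<open>w\<close> and
      \<open>of_nat n * w\<close> must be shown to lie there.\<close>
    have le: "norm (of_nat m * w) \<le> norm (of_nat (Suc n) * w)" if "m \<le> Suc n" for m
      unfolding norm_mult norm_of_nat using that by (intro mult_right_mono) auto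
    have "norm w < d" "norm (of_nat n * w) < d"
      using le[of 1] le[of n] Suc.prems by auto
    moreover have "of_nat (Suc n) * w = w + of_nat n * w"
      by (simp add: distrib_right)
    ultimately show ?case
      using add[of w "of_nat n * w"] Suc by (simp add: distrib_right)
  qed
  show ?thesis
  proof (cases "z = 0")
    case True
    then show ?thesis using k0 by simp
  next
    case False
    have "((\<lambda>y. k y / y) \<longlongrightarrow> \<alpha>) (at 0)"
      using deriv k0 by (simp add: has_field_derivative_iff)
    \<comment> \<open>The shift to \<open>Suc n\<close> avoids \<open>z / 0 = 0\<close>, so all
      points lie in a punctured neighbourhood of 0.\<close>
    moreover have "filterlim (\<lambda>n. z / of_nat (Suc n)) (at 0) sequentially"
    proof -
      have "(\<lambda>n. z * inverse (of_nat (Suc n))) \<longlonglongrightarrow> z * 0"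
        by (intro tendsto_intros LIMSEQ_Suc lim_inverse_n)
      then show ?thesis
        using False unfolding filterlim_at
        by (auto simp: divide_inverse simp del: of_nat_Suc)
    qed
    ultimately have "(\<lambda>n. k (z / of_nat (Suc n)) / (z / of_nat (Suc n))) \<longlonglongrightarrow> \<alpha>"
      by (rule filterlim_compose)
    moreover have "k (z / of_nat (Suc n)) / (z / of_nat (Suc n)) = k z / z" for n
      using mult[of "Suc n" "z / of_nat (Suc n)"] z
      by (simp add: field_simps del: of_nat_Suc)
    ultimately have "(\<lambda>n. k z / z) \<longlonglongrightarrow> \<alpha>"
      by (simp only:)
    then have "k z / z = \<alpha>"
      by (rule LIMSEQ_unique[OF tendsto_const])
    then show ?thesis
      using False by (simp add: field_simps)
  qed
qed

text \<open>Division by a large \<open>n\<close> brings \<open>z\<close> into the disc where the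
  lift is multiplication by its derivative; multiplication by \<open>n\<close> leads back.\<close>

lemma End_torus_eq_mult:
  assumes f: "f \<in> End_torus \<Lambda>"
  obtains \<alpha> where "\<And>z. f (z +o \<Lambda>) = (\<alpha> * z) +o \<Lambda>"
proof -
  obtain d k \<alpha> where d: "d > 0" and k: "(k has_field_derivative \<alpha>) (at 0)"
    "\<And>u w. norm u < d \<Longrightarrow> norm w < d \<Longrightarrow> norm (u + w) < d \<Longrightarrow> k (u + w) = k u + k w"
    and fk: "\<And>w. norm w < d \<Longrightarrow> f (w +o \<Lambda>) = k w +o \<Lambda>"
    by (rule End_torus_local_lift[OF f]) (rule that)
  have "f (z +o \<Lambda>) = (\<alpha> * z) +o \<Lambda>" for z
  proof -
    obtain n where n: "norm z / d < of_nat n"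
      using reals_Archimedean2 by blast
    then have "n > 0"
      using d by (cases n) (auto simp: field_simps)
    have small: "norm (z / of_nat n) < d"
      using n d \<open>n > 0\<close> by (simp add: norm_divide field_simps)
    have "f ((z / of_nat n) +o \<Lambda>) = (\<alpha> * (z / of_nat n)) +o \<Lambda>"
      using fk[OF small] locally_additive_eq_mult[OF k small] by simp
    from End_torus_of_nat_mult[OF f this, of n] show ?thesis
      using \<open>n > 0\<close> by simp
  qed
  then show ?thesis
    by (rule that)
qed

section \<open>Complex multiplication and the multipliers of the lattice\<close>

lemma complex_multiplication_multiplier:
  assumes "complex_multiplication \<Lambda>"
  obtains \<alpha> where "\<alpha> \<notin> \<int>" "\<And>x. x \<in> \<Lambda> \<Longrightarrow> \<alpha> * x \<in> \<Lambda>"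
proof -
  obtain f where f: "f \<in> End_torus \<Lambda>" "f \<notin> range (int_mult \<Lambda>)"
    using assms int_mult_in_End[OF lattice] by (auto simp: complex_multiplication_def)
  obtain \<alpha> where \<alpha>: "\<And>z. f (z +o \<Lambda>) = (\<alpha> * z) +o \<Lambda>"
    by (rule End_torus_eq_mult[OF f(1)]) (rule that)
  have "\<alpha> \<notin> \<int>"
  proof
    assume "\<alpha> \<in> \<int>"
    then obtain n where n: "\<alpha> = of_int n"
      by (auto simp: Ints_def)
    have "f = int_mult \<Lambda> n"
    proof (rule extensionalityI)
      show "f \<in> extensional (torus \<Lambda>)"
        using f(1) by (simp add: End_torus_def PiE_def)
      show "int_mult \<Lambda> n \<in> extensional (torus \<Lambda>)"
        by (simp add: int_mult_def)
      show "f X = int_mult \<Lambda> n X" if "X \<in> torus \<Lambda>" for X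
        using that \<alpha> n by (auto simp: torus_def int_mult_coset[OF lattice])
    qed
    then show False
      using f(2) by blast
  qed
  moreover have "\<alpha> * x \<in> \<Lambda>" if "x \<in> \<Lambda>" for x
  proof -
    have "x +o \<Lambda> = \<Lambda>"
      using that by (simp add: lattice_coset_eq_lattice_iff[OF lattice])
    then have "(\<alpha> * x) +o \<Lambda> = \<Lambda>"
      using \<alpha>[of x] \<alpha>[of 0] by simp
    then show ?thesis
      by (simp add: lattice_coset_eq_lattice_iff[OF lattice])
  qed
  ultimately show ?thesis
    using that by blast
qed

lemma real_multiplier_Ints:
  assumes "\<alpha> \<in> \<real>" and \<alpha>: "\<And>x. x \<in> \<Lambda> \<Longrightarrow> \<alpha> * x \<in> \<Lambda>"
  shows "\<alpha> \<in> \<int>"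
proof (rule ccontr)
  assume "\<alpha> \<notin> \<int>"
  obtain r where r: "\<alpha> = of_real r"
    using \<open>\<alpha> \<in> \<real>\<close> by (auto simp: Reals_def)
  \<comment> \<open>Removing the integer part of \<open>r\<close> leaves a multiplier that still
    preserves \<Lambda> and, lying strictly between 0 and 1, contracts.\<close>
  define \<beta> where "\<beta> = frac r"
  have \<beta>_eq: "of_real \<beta> * x = \<alpha> * x - of_int \<lfloor>r\<rfloor> * x" for x :: complex
    by (simp add: \<beta>_def frac_def r algebra_simps)
  have \<beta>: "of_real \<beta> * x \<in> \<Lambda>" if "x \<in> \<Lambda>" for x
    unfolding \<beta>_eq using that
    by (intro lattice_diff[OF lattice] \<alpha> lattice_of_int_mult[OF lattice])
  have "r \<notin> \<int>"
    using \<open>\<alpha> \<notin> \<int>\<close> r by (auto simp: Ints_def)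
  then have "0 < \<beta>" "\<beta> < 1"
    using frac_ge_0[of r] frac_eq_0_iff[of r] frac_lt_1[of r] by (auto simp: \<beta>_def)
  obtain e where e: "e > 0" "\<And>x. x \<in> \<Lambda> \<Longrightarrow> norm x < e \<Longrightarrow> x = 0"
    using lattice_gap[OF lattice] by blast
  \<comment> \<open>The contraction needs a nonzero period to act on; one exists since \<Lambda>
    spans the plane.\<close>
  have "\<not> \<Lambda> \<subseteq> {0}"
  proof
    assume "\<Lambda> \<subseteq> {0}"
    then have "span \<Lambda> \<subseteq> {0 :: complex}"
      using span_mono[of \<Lambda> "{0}"] by simp
    then show False
      using lattice by (force simp: lattice_in_def)
  qed
  then obtain x where x: "x \<in> \<Lambda>" "x \<noteq> 0"
    by blast
  have pow: "of_real \<beta> ^ n * x \<in> \<Lambda>" for n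
    by (induction n) (use x \<beta> in \<open>auto simp: mult.assoc\<close>)
  obtain n where "\<beta> ^ n < e / norm x"
    using real_arch_pow_inv[of "e / norm x" \<beta>] e(1) x(2) \<open>\<beta> < 1\<close> by auto
  then have "norm (of_real \<beta> ^ n * x) < e"
    using x(2) \<open>0 < \<beta>\<close> by (simp add: norm_mult norm_power field_simps)
  with e(2)[OF pow] x(2) \<open>0 < \<beta>\<close> show False
    by fastforce
qed

section \<open>Elliptic curves as images of complex lines\<close>

lemma complex_line_subset_lattice:
  assumes "\<And>t. t * c \<in> \<Lambda>"
  shows "c = 0"
proof (rule ccontr)
  assume "c \<noteq> 0"
  obtain e where e: "e > 0" "\<And>x. x \<in> \<Lambda> \<Longrightarrow> norm x < e \<Longrightarrow> x = 0"
    using lattice_gap[OF lattice] by blast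
  \<comment> \<open>The multiples of a nonzero \<open>c\<close> fill the plane, including this
    nonzero point inside the gap.\<close>
  have "of_real (e / 2) \<in> \<Lambda>"
    using assms[of "of_real (e / 2) / c"] \<open>c \<noteq> 0\<close> by simp
  then have "complex_of_real (e / 2) = 0"
    by (rule e(2)) (use e(1) in simp)
  then show False
    using e(1) by simp
qed

text \<open>Since \<open>w $ a = 1\<close>, the coordinate \<open>a\<close> of \<open>z *s w\<close>
  is \<open>z\<close> itself. Hence the line meets the lattice exactly in a copy of \<Lambda>, and
  discreteness can be read off in that coordinate.\<close>

lemma elliptic_curve_in_complex_line:
  fixes w :: "complex ^ 'n"
  assumes w: "\<And>x i. x \<in> \<Lambda> \<Longrightarrow> x * w $ i \<in> \<Lambda>" and a: "w $ a = 1"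
  shows "elliptic_curve_in (lattice_power \<Lambda>) (range (\<lambda>z. (z *s w) +o lattice_power \<Lambda>))"
  unfolding elliptic_curve_in_def complex_subtorus_def
proof (intro exI conjI)
  let ?L = "lattice_power \<Lambda> :: (complex ^ 'n) set"
  define W where "W = vec.span {w}"
  have W: "W = range (\<lambda>z. z *s w)"
    by (simp add: W_def vec.span_singleton)
  have int: "?L \<inter> W = (\<lambda>z. z *s w) ` \<Lambda>"
  proof (intro equalityI subsetI)
    fix x assume "x \<in> ?L \<inter> W"
    then obtain z where z: "x = z *s w"
      by (auto simp: W)
    moreover have "z \<in> \<Lambda>"
      using \<open>x \<in> ?L \<inter> W\<close> z a by (force simp: lattice_power_def dest: spec[of _ a])
    ultimately show "x \<in> (\<lambda>z. z *s w) ` \<Lambda>"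
      by blast
  next
    fix x assume "x \<in> (\<lambda>z. z *s w) ` \<Lambda>"
    then show "x \<in> ?L \<inter> W"
      using w by (auto simp: W lattice_power_def)
  qed
  have "w \<noteq> 0"
    using a by auto
  show "vec.subspace W"
    by (simp add: W_def vec.subspace_span)
  show "vec.dim W = 1"
    using \<open>w \<noteq> 0\<close> by (simp add: W_def)
  show "range (\<lambda>z. (z *s w) +o ?L) = (\<lambda>z. z +o ?L) ` W"
    by (simp add: W image_image)
  have lin: "linear (\<lambda>z. z *s w)"
    by (rule linearI) (auto simp: vec_eq_iff algebra_simps)
  show "lattice_in W (?L \<inter> W)"
    unfolding lattice_in_def
  proof (intro conjI ballI)
    show "0 \<in> ?L \<inter> W"
      by (simp add: W_def vec.span_zero lattice_power_def lattice_zero[OF lattice])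
    show "x - y \<in> ?L \<inter> W" if "x \<in> ?L \<inter> W" "y \<in> ?L \<inter> W" for x y
      using that by (auto simp: W_def vec.span_diff lattice_power_def lattice_diff[OF lattice])
    show "span (?L \<inter> W) = W"
      using lattice linear_span_image[OF lin, of \<Lambda>]
      unfolding int by (simp add: W lattice_in_def)
    obtain e where e: "e > 0" "\<And>x. x \<in> \<Lambda> \<Longrightarrow> norm x < e \<Longrightarrow> x = 0"
      using lattice_gap[OF lattice] by blast
    show "discrete (?L \<inter> W)"
    proof (rule discreteI)
      fix x assume x: "x \<in> ?L \<inter> W"
      have "y = x" if y: "y \<in> ?L \<inter> W" "dist x y < e" for y
      proof -
        obtain s t where st: "s \<in> \<Lambda>" "x = s *s w" "t \<in> \<Lambda>" "y = t *s w"
          using x y(1) by (auto simp: int)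
        have "norm (s - t) < e"
          using dist_vec_nth_le[of x a y] y(2) a st by (simp add: dist_norm)
        then have "s - t = 0"
          using st by (intro e(2) lattice_diff[OF lattice])
        then show ?thesis
          using st by simp
      qed
      then show "x isolated_in (?L \<inter> W)"
        using x e(1) by (auto simp: isolated_in_dist_Ex_iff)
    qed
  qed
qed

text \<open>The form \<open>p * x $ a - q * x $ b\<close> vanishes on the line of \<open>u\<close>
  and maps \<open>lattice_power \<Lambda>\<close> into \<Lambda>. By the inclusion it sends the
  whole line of \<open>w\<close> into \<Lambda>, which forces it to vanish there too.\<close>

lemma complex_line_image_subset:
  fixes w u :: "complex ^ 'n"
  assumes "range (\<lambda>z. (z *s w) +o lattice_power \<Lambda>) \<subseteq> range (\<lambda>z. (z *s u) +o lattice_power \<Lambda>)"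
    and A: "\<And>x. x \<in> \<Lambda> \<Longrightarrow> p * x \<in> \<Lambda>" and B: "\<And>x. x \<in> \<Lambda> \<Longrightarrow> q * x \<in> \<Lambda>"
    and "p * u $ a = q * u $ b"
  shows "p * w $ a = q * w $ b"
proof -
  have "t * (p * w $ a - q * w $ b) \<in> \<Lambda>" for t
  proof -
    obtain s where s: "(t *s w) +o lattice_power \<Lambda> = (s *s u) +o lattice_power \<Lambda>"
      using assms(1) by blast
    have "t *s w + 0 \<in> (t *s w) +o lattice_power \<Lambda>"
      by (rule set_plus_intro2) (simp add: lattice_power_def lattice_zero[OF lattice])
    then obtain l where l: "l \<in> lattice_power \<Lambda>" "t *s w = s *s u + l"
      unfolding s by (auto simp: elt_set_plus_def)
    have comp: "t * w $ i = s * u $ i + l $ i" for i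
      using arg_cong[OF l(2), of "\<lambda>x. x $ i"] by simp
    have "t * (p * w $ a - q * w $ b) = p * (t * w $ a) - q * (t * w $ b)"
      by (simp add: algebra_simps)
    also have "\<dots> = s * (p * u $ a - q * u $ b) + (p * l $ a - q * l $ b)"
      unfolding comp by (simp add: algebra_simps)
    finally show ?thesis
      using l(1) assms(4) by (auto simp: lattice_power_def intro: lattice_diff[OF lattice] A B)
  qed
  then show ?thesis
    using complex_line_subset_lattice by fastforce
qed

lemma ordinary_curve_eq_range:
  "ordinary_curve \<Lambda> v = range (\<lambda>z. (z *s (\<chi> i. of_int (v $ i))) +o lattice_power \<Lambda>)"
  by (simp add: ordinary_curve_def torus_def image_image ordinary_map_coset[OF lattice]
      vector_scalar_mult_def mult.commute)

end

section \<open>Infinitely many extra-ordinary curves\<close>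

theorem proposition3p5:
  fixes \<Lambda> :: "complex set"
  assumes "lattice_in UNIV \<Lambda>"
    and "complex_multiplication \<Lambda>"
    and "CARD('n::finite) > 1"
  shows "infinite {C :: (complex ^ 'n) set set. extra_ordinary \<Lambda> C}"
proof -
  note lattice = assms(1)
  obtain \<alpha> where "\<alpha> \<notin> \<int>" and \<alpha>: "\<And>x. x \<in> \<Lambda> \<Longrightarrow> \<alpha> * x \<in> \<Lambda>"
    using complex_multiplication_multiplier[OF lattice assms(2)] by blast
  then have "\<alpha> \<notin> \<real>"
    using real_multiplier_Ints[OF lattice] by blast
  then have "\<alpha> \<noteq> 0"
    by auto
  obtain a b :: 'n where "a \<noteq> b"
    using assms(3) card_le_Suc0_iff_eq[of "UNIV :: 'n set"] by auto
  define w :: "nat \<Rightarrow> complex ^ 'n"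
    where "w k = (\<chi> i. if i = a then 1 else if i = b then of_nat k * \<alpha> else 0)" for k
  define C where "C k = range (\<lambda>z. (z *s w k) +o lattice_power \<Lambda>)" for k
  have w: "w k $ a = 1" "w k $ b = of_nat k * \<alpha>" for k
    using \<open>a \<noteq> b\<close> by (auto simp: w_def)
  have k\<alpha>: "of_nat k * \<alpha> * x \<in> \<Lambda>" if "x \<in> \<Lambda>" for k x
    using lattice_of_int_mult[OF lattice \<alpha>[OF that], of "int k"] by (simp add: mult.assoc)
  \<comment> \<open>The index 0 is left out: \<open>w 0\<close> is a standard basis vector, so
    \<open>C 0\<close> is ordinary.\<close>
  have "extra_ordinary \<Lambda> (C (Suc k))" for k
    unfolding extra_ordinary_def
  proof (intro conjI notI)
    show "elliptic_curve_in (lattice_power \<Lambda>) (C (Suc k))"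
      unfolding C_def
    proof (rule elliptic_curve_in_complex_line[OF lattice])
      show "x * w (Suc k) $ i \<in> \<Lambda>" if "x \<in> \<Lambda>" for x i
        using that k\<alpha>[OF that, of "Suc k"] lattice_zero[OF lattice]
        by (auto simp: w_def mult.commute)
    qed (rule w)
    assume "\<exists>v. primitive v \<and> C (Suc k) = ordinary_curve \<Lambda> v"
    then obtain v where v: "C (Suc k) = ordinary_curve \<Lambda> v"
      by blast
    let ?u = "(\<chi> i. of_int (v $ i)) :: complex ^ 'n"
    have eq: "C (Suc k) = range (\<lambda>z. (z *s ?u) +o lattice_power \<Lambda>)"
      by (simp add: v ordinary_curve_eq_range[OF lattice])
    \<comment> \<open>The form with coefficients \<open>v $ b\<close> and \<open>v $ a\<close>
      vanishes on \<open>?u\<close> by commutativity; this is its vanishing at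
      \<open>w (Suc k)\<close>.\<close>
    have rel: "of_int (v $ b) = of_int (v $ a) * (of_nat (Suc k) * \<alpha>)"
      using complex_line_image_subset[OF lattice, of "w (Suc k)" ?u "of_int (v $ b)" "of_int (v $ a)" a b]
        lattice_of_int_mult[OF lattice] eq w unfolding C_def by (simp add: mult.commute)
    have "v $ a = 0"
    proof (rule ccontr)
      assume "v $ a \<noteq> 0"
      then have "\<alpha> = of_int (v $ b) / (of_int (v $ a) * of_nat (Suc k))"
        using rel by (simp add: field_simps del: of_nat_Suc)
      then have "\<alpha> \<in> \<real>"
        by (metis Reals_divide Reals_mult Reals_of_int Reals_of_nat)
      then show False
        using \<open>\<alpha> \<notin> \<real>\<close> by blast
    qed
    \<comment> \<open>Now the coordinate form \<open>x $ a\<close> itself vanishes on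
      \<open>?u\<close>, although it is 1 at \<open>w (Suc k)\<close>.\<close>
    then have "1 * w (Suc k) $ a = 0 * w (Suc k) $ b"
      using complex_line_image_subset[OF lattice, of "w (Suc k)" ?u 1 0 a b]
        eq lattice_zero[OF lattice] unfolding C_def by simp
    then show False
      by (simp add: w)
  qed
  moreover have "inj C"
  proof (rule injI)
    fix k m assume "C k = C m"
    \<comment> \<open>The form that vanishes on \<open>w m\<close>, evaluated at \<open>w k\<close>,
      compares the two slopes.\<close>
    then have "(of_nat m * \<alpha>) * w k $ a = 1 * w k $ b"
      using complex_line_image_subset[OF lattice, of "w k" "w m" "of_nat m * \<alpha>" 1 a b] k\<alpha> w
      unfolding C_def by simp
    then show "k = m"
      using \<open>\<alpha> \<noteq> 0\<close> by (simp add: w)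
  qed
  then have "infinite (range (\<lambda>k. C (Suc k)))"
    by (intro range_inj_infinite) (auto simp: inj_on_def)
  ultimately show ?thesis
    by (auto elim!: infinite_super[rotated])
qed

end
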